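(* Let $\mathcal{D}_{\mathrm{pp}}=\{(a,p)\in\mathbb{Z}_{>0}^2: a,p\text{ are prime and }2<p<a\}$. There do not exist finitely many polynomials $f_1,\ldots,f_m\in\mathbb{C}[X_1,X_2]$ such that, for every $(a,p)\in\mathcal{D}_{\mathrm{pp}}$, one has $G(a,p)=f_i(a,p)$ for at least one index $i$. The same statement holds for finite collections of rational functions: there do not exist finitely many $R_1,\ldots,R_m\in\mathbb{C}(X_1,X_2)$ such that, for every $(a,p)\in\mathcal{D}_{\mathrm{pp}}$, there is at least one index $i$ for which $R_i$ is defined at $(a,p)$ and $G(a,p)=R_i(a,p)$. Consequently, there is no finite collection of polynomials in $\mathbb{C}[X_1,X_2]$ or rational functions in $\mathbb{C}(X_1,X_2)$ such that, for all integers $a>p\ge 2$, at least one member of the collection is defined at $(a,p)$ and takes the value $G(a,p)$ there.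
   Context: $\mathbb{N}$ denotes the non-negative integers and $\mathbb{Z}_{>0}$ the positive integers. For $a\ge 2$, $\langle a,a+1\rangle=\{xa+y(a+1):x,y\in\mathbb{N}\}$. For $S\subseteq\mathbb{N}$ a numerical semigroup (contains $0$, closed under addition, finite complement) and $p\in\mathbb{Z}_{>0}$, $\frac{S}{p}=\{n\in\mathbb{N}:pn\in S\}$; for $S\ne\mathbb{N}$ the Frobenius number is $g(S)=\max(\mathbb{N}\setminus S)$. Set $G(a,p)=g\!\left(\frac{\langle a,a+1\rangle}{p}\right)$. A rational function, written $A/B$ with $A,B$ polynomials and $B\neq 0$, is defined at a point where $B$ does not vanish. *)

theory Defs
  imports Complex_Main "HOL-Computational_Algebra.Computational_Algebra"
begin

definition numerical_semigroup :: "nat set \<Rightarrow> bool" where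
  "numerical_semigroup S \<longleftrightarrow>
     0 \<in> S \<and> (\<forall>x\<in>S. \<forall>y\<in>S. x + y \<in> S) \<and> finite (UNIV - S)"

definition consecutive_semigroup :: "nat \<Rightarrow> nat set" where
  "consecutive_semigroup a = {x * a + y * (a + 1) | x y. True}"

definition quotient_semigroup :: "nat set \<Rightarrow> nat \<Rightarrow> nat set" where
  "quotient_semigroup S p = {n. p * n \<in> S}"

text \<open>Only meaningful for a numerical semigroup other than the whole of the natural numbers;
  otherwise the maximum is taken over an empty or infinite set and is unspecified.\<close>

definition frobenius_number :: "nat set \<Rightarrow> nat" where
  "frobenius_number S = Max (UNIV - S)"

definition G :: "nat \<Rightarrow> nat \<Rightarrow> nat" where
  "G a p = frobenius_number (quotient_semigroup (consecutive_semigroup a) p)"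

definition D_pp :: "(nat \<times> nat) set" where
  "D_pp = {(a, p). prime a \<and> prime p \<and> 2 < p \<and> p < a}"

text \<open>The ring of polynomials in two variables over the complex numbers is represented as
  \<open>\<complex>[X\<^sub>1][X\<^sub>2]\<close>: the coefficients, of type \<^typ>\<open>complex poly\<close>, are polynomials in the
  first variable, and the outer variable is the second one. Its fraction field is the field of
  rational functions in two variables.\<close>

type_synonym bipoly = "complex poly poly"
type_synonym birat = "complex poly poly fract"

definition poly_at :: "bipoly \<Rightarrow> complex \<Rightarrow> complex \<Rightarrow> complex" where
  "poly_at f x y = poly (poly f [:y:]) x"

text \<open>A rational function is an element of the fraction field, so it is defined at a point
  as soon as some representation \<open>A/B\<close> of it has a denominator not vanishing there.\<close>

definition rat_defined_at :: "birat \<Rightarrow> complex \<Rightarrow> complex \<Rightarrow> bool" where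
  "rat_defined_at R x y \<longleftrightarrow> (\<exists>A B. B \<noteq> 0 \<and> R = Fract A B \<and> poly_at B x y \<noteq> 0)"

definition rat_at :: "birat \<Rightarrow> complex \<Rightarrow> complex \<Rightarrow> complex" where
  "rat_at R x y = (THE v. \<exists>A B. B \<noteq> 0 \<and> R = Fract A B \<and> poly_at B x y \<noteq> 0 \<and>
     v = poly_at A x y / poly_at B x y)"

lemma poly_at_mult: "poly_at (f * g) x y = poly_at f x y * poly_at g x y"
  by (simp add: poly_at_def)

lemma rat_at_Fract:
  assumes "poly_at B x y \<noteq> 0"
  shows "rat_defined_at (Fract A B) x y"
    and "rat_at (Fract A B) x y = poly_at A x y / poly_at B x y"
proof -
  have B: "B \<noteq> 0" using assms by (auto simp: poly_at_def)
  show "rat_defined_at (Fract A B) x y"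
    using assms B unfolding rat_defined_at_def by blast
  show "rat_at (Fract A B) x y = poly_at A x y / poly_at B x y"
    unfolding rat_at_def
  proof (rule the_equality)
    show "\<exists>A' B'. B' \<noteq> 0 \<and> Fract A B = Fract A' B' \<and> poly_at B' x y \<noteq> 0 \<and>
      poly_at A x y / poly_at B x y = poly_at A' x y / poly_at B' x y"
      using assms B by blast
  next
    fix v assume "\<exists>A' B'. B' \<noteq> 0 \<and> Fract A B = Fract A' B' \<and> poly_at B' x y \<noteq> 0 \<and>
      v = poly_at A' x y / poly_at B' x y"
    then obtain A' B' where *: "B' \<noteq> 0" "Fract A B = Fract A' B'" "poly_at B' x y \<noteq> 0"
      "v = poly_at A' x y / poly_at B' x y" by blast
    have "A * B' = A' * B" using *(1,2) B by (simp add: eq_fract)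
    hence "poly_at A x y * poly_at B' x y = poly_at A' x y * poly_at B x y"
      by (metis poly_at_mult)
    thus "v = poly_at A x y / poly_at B x y"
      using *(3,4) assms by (simp add: frac_eq_eq)
  qed
qed

text \<open>The Frobenius number in the definition of \<open>G a p\<close> is meaningful
  whenever \<open>2 \<le> p < a\<close>.\<close>

lemma numerical_semigroup_consecutive:
  assumes "a \<ge> 2"
  shows "numerical_semigroup (consecutive_semigroup a)"
  unfolding numerical_semigroup_def
proof (intro conjI ballI)
  show "0 \<in> consecutive_semigroup a" by (auto simp: consecutive_semigroup_def)
next
  fix u v assume "u \<in> consecutive_semigroup a" "v \<in> consecutive_semigroup a"
  then obtain x y x' y' where "u = x * a + y * (a + 1)" "v = x' * a + y' * (a + 1)"
    unfolding consecutive_semigroup_def by blast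
  hence "u + v = (x + x') * a + (y + y') * (a + 1)" by (simp add: algebra_simps)
  thus "u + v \<in> consecutive_semigroup a" unfolding consecutive_semigroup_def by blast
next
  have "n \<in> consecutive_semigroup a" if "n \<ge> a * a" for n
  proof -
    have "a \<le> n div a" using that assms by (simp add: less_eq_div_iff_mult_less_eq)
    moreover have "n mod a < a" using assms by simp
    ultimately have "(n div a - n mod a) * a + (n mod a) * (a + 1) = n div a * a + n mod a"
      by (simp add: diff_mult_distrib)
    hence "n = (n div a - n mod a) * a + (n mod a) * (a + 1)" by simp
    thus ?thesis unfolding consecutive_semigroup_def by blast
  qed
  hence "UNIV - consecutive_semigroup a \<subseteq> {..<a * a}" by (auto simp: not_le[symmetric])
  thus "finite (UNIV - consecutive_semigroup a)" using finite_subset by blast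
qed

lemma numerical_semigroup_quotient:
  assumes "numerical_semigroup S" "p > 0"
  shows "numerical_semigroup (quotient_semigroup S p)"
proof -
  have "(*) p ` (UNIV - quotient_semigroup S p) \<subseteq> UNIV - S"
    by (auto simp: quotient_semigroup_def)
  hence "finite ((*) p ` (UNIV - quotient_semigroup S p))"
    using assms(1) finite_subset unfolding numerical_semigroup_def by blast
  moreover have "inj_on ((*) p) (UNIV - quotient_semigroup S p)"
    using assms(2) by (auto simp: inj_on_def)
  ultimately have "finite (UNIV - quotient_semigroup S p)" by (rule finite_imageD)
  thus ?thesis using assms(1)
    by (auto simp: numerical_semigroup_def quotient_semigroup_def distrib_left)
qed

lemma quotient_consecutive_ne_UNIV:
  assumes "0 < p" "p < a"
  shows "quotient_semigroup (consecutive_semigroup a) p \<noteq> UNIV"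
proof -
  have False if "p = x * a + y * (a + 1)" for x y
    using that assms by (cases x; cases y) auto
  hence "1 \<notin> quotient_semigroup (consecutive_semigroup a) p"
    unfolding quotient_semigroup_def consecutive_semigroup_def by auto
  thus ?thesis by blast
qed

end

theory Submission
  imports Defs "HOL-Real_Asymp.Real_Asymp"
begin

text \<open>One has \<open>p G(a, p) = a\<^sup>2 - i a - s\<close> with \<open>0 \<le> i, s \<le> p\<close>. For fixed \<open>p\<close>, a rational function
  that takes the value \<open>G(a, p)\<close> for many \<open>a\<close> is therefore equal to \<open>(x\<^sup>2 - i x - s)/p\<close>
  for one pair \<open>(i, s)\<close>, and \<open>a\<close> is then one of the at most two roots of
  \<open>x\<^sup>2 - i x - s\<close> modulo \<open>p\<close>. So \<open>m\<close> rational functions covering all prime pairs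
  would confine the primes \<open>a > p\<close>, up to \<open>O(p\<^sup>2)\<close> exceptions, to \<open>2m\<close> residue classes modulo
  almost every prime \<open>p\<close>. Dirichlet's theorem would refute this; it is avoided here by sieving
  the primes up to \<open>2^(l\<^sup>2)\<close> with the moduli \<open>p \<le> 2^l\<close>: at most \<open>2m\<close> integers survive, whereas
  the exceptions number only \<open>O(8^l)\<close>. This contradicts Chebyshev's lower bound for the number
  of primes.\<close>

section \<open>Chebyshev's lower bound for the number of primes\<close>

text \<open>The reciprocals \<open>1 / ((n+1) (n choose k))\<close> form Leibniz's harmonic triangle, in which each entry
  is a difference of two others; this gives the identity \<open>u v + v w = u w\<close> in the induction.\<close>

lemma dvd_Leibniz_triangle:
  fixes M :: nat
  assumes "\<And>j. 1 \<le> j \<Longrightarrow> j \<le> Suc n \<Longrightarrow> j dvd M" "k \<le> n"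
  shows "Suc n * (n choose k) dvd M"
  using assms
proof (induction n arbitrary: k)
  case 0
  then show ?case by simp
next
  case (Suc n)
  note outer = Suc
  from Suc.prems(2) show ?case
  proof (induction k)
    case 0
    then show ?case using outer(2)[of "Suc (Suc n)"] by simp
  next
    case (Suc k)
    define u where "u = Suc (Suc n) * (Suc n choose Suc k)"
    define v where "v = Suc n * (n choose k)"
    define w where "w = Suc (Suc n) * (Suc n choose k)"
    have kn: "k \<le> n" using Suc.prems by simp
    have pos: "u > 0" "v > 0" "w > 0"
      using kn by (auto simp: u_def v_def w_def simp del: binomial_Suc_Suc)
    have "v dvd M" unfolding v_def
      by (rule outer(1)) (use outer(2) kn in auto)
    moreover have "w dvd M" unfolding w_def using Suc by simp
    moreover have "u * v + v * w = u * w"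
    proof -
      have 1: "Suc k * (Suc n choose Suc k) = Suc n * (n choose k)"
        by (rule Suc_times_binomial)
      have 2: "(Suc n - k) * (Suc n choose k) = Suc n * (n choose k)"
        by (metis binomial_absorb_comp diff_Suc_1)
      have "Suc k * u = Suc (Suc n) * v" "(Suc n - k) * w = Suc (Suc n) * v"
        using 1 2 unfolding u_def v_def w_def by (metis mult.left_commute)+
      moreover have "Suc k + (Suc n - k) = Suc (Suc n)" using kn by simp
      ultimately have "Suc (Suc n) * (u * w) = Suc (Suc n) * (u * v + v * w)"
        by (metis (no_types, opaque_lifting) add.commute distrib_left distrib_right mult.assoc mult.commute)
      thus ?thesis by (metis mult_cancel1 nat.distinct(1))
    qed
    ultimately show ?case
    proof -
      assume "v dvd M" "w dvd M" and eq: "u * v + v * w = u * w"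
      then obtain c d where c: "M = v * c" and d: "M = w * d" by (metis dvdE)
      \<comment> \<open>As \<open>u * v + v * w = u * w\<close>, one has M/u = M/v - M/w = c - d.
        Over \<open>int\<close> this difference is not truncated.\<close>
      have "int u * (int c - int d) = int M"
      proof -
        have eq': "int u * int v + int v * int w = int u * int w"
          using eq by (metis of_nat_add of_nat_mult)
        have c': "int M = int v * int c" and d': "int M = int w * int d"
          using c d by (simp_all del: of_nat_mult add: of_nat_mult[symmetric])
        have "int v * int w * (int u * (int c - int d)) =
            int u * int w * (int v * int c) - int u * int v * (int w * int d)"
          by (simp add: algebra_simps)
        also have "\<dots> = (int u * int w - int u * int v) * int M"
          using c' d' by (simp add: algebra_simps)
        also have "int u * int w - int u * int v = int v * int w" using eq' by simp
        finally show ?thesis using pos by simp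
      qed
      hence "int u dvd int M" by (metis dvd_triv_left)
      thus ?thesis unfolding u_def by (simp only: int_dvd_int_iff)
    qed
  qed
qed

text \<open>The product \<open>M\<close> below is the least common multiple of \<open>1, \<dots>, n+1\<close>.\<close>

lemma two_power_le_power_card_primes:
  "2 ^ n \<le> Suc n ^ card {p. prime p \<and> p \<le> Suc n}"
proof -
  define P where "P = {p::nat. prime p \<and> p \<le> Suc n}"
  define e where "e p = (GREATEST e. p ^ e \<le> Suc n)" for p :: nat
  define M where "M = (\<Prod>p\<in>P. p ^ e p)"
  have fin: "finite P" unfolding P_def by simp
  have bound: "y \<le> Suc n" if "p \<in> P" "p ^ y \<le> Suc n" for p y
  proof -
    have "1 < p" using that(1) by (auto simp: P_def prime_gt_Suc_0_nat)
    thus "y \<le> Suc n"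
      using that(2) power_gt_expt[of p y] by linarith
  qed
  have e1: "p ^ e p \<le> Suc n" if "p \<in> P" for p
    unfolding e_def using GreatestI_nat[of "\<lambda>e. p ^ e \<le> Suc n" 0, OF _ bound[OF that]] by simp
  have e2: "y \<le> e p" if "p \<in> P" "p ^ y \<le> Suc n" for p y
    unfolding e_def using Greatest_le_nat[of "\<lambda>e. p ^ e \<le> Suc n" y, OF _ bound[OF that(1)]] that(2) .
  have Mpos: "M > 0" unfolding M_def P_def by (auto intro!: prod_pos simp: prime_gt_0_nat)
  have "j dvd M" if j: "1 \<le> j" "j \<le> Suc n" for j
  proof -
    have "j = (\<Prod>p\<in>prime_factors j. p ^ multiplicity p j)"
      using j prod_prime_factors[of j] by simp
    also have "\<dots> dvd M" unfolding M_def
    proof (rule prod_dvd_prod_subset2[OF fin])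
      show "prime_factors j \<subseteq> P"
      proof
        fix p assume "p \<in> prime_factors j"
        hence "prime p" "p dvd j" by auto
        moreover from \<open>p dvd j\<close> have "p \<le> j" using j by (intro dvd_imp_le) auto
        ultimately show "p \<in> P" using j by (simp add: P_def)
      qed
      fix p assume "p \<in> prime_factors j"
      hence "p \<in> P" using \<open>prime_factors j \<subseteq> P\<close> by blast
      moreover have "p ^ multiplicity p j \<le> Suc n"
        using dvd_imp_le[OF multiplicity_dvd, of j p] j by simp
      ultimately show "p ^ multiplicity p j dvd p ^ e p"
        by (intro le_imp_power_dvd e2)
    qed
    finally show ?thesis .
  qed
  \<comment> \<open>The central coefficient is the largest in its row, so \<open>n + 1\<close> times
    it is at least the row sum \<open>2 ^ n\<close>.\<close>
  hence dvd: "Suc n * (n choose (n div 2)) dvd M"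
    by (rule dvd_Leibniz_triangle) auto
  have "2 ^ n = (\<Sum>k\<le>n. n choose k)" by (simp add: choose_row_sum)
  also have "\<dots> \<le> (\<Sum>k\<le>n. n choose (n div 2))"
    by (intro sum_mono binomial_maximum)
  also have "\<dots> = Suc n * (n choose (n div 2))" by simp
  also have "\<dots> \<le> M" using dvd Mpos by (rule dvd_imp_le)
  also have "\<dots> \<le> (\<Prod>p\<in>P. Suc n)" unfolding M_def by (intro prod_mono) (use e1 in auto)
  also have "\<dots> = Suc n ^ card P" by simp
  finally show ?thesis unfolding P_def .
qed

lemma card_primes_le_two_power:
  "2 ^ L \<le> Suc (L * card {p::nat. prime p \<and> p \<le> 2 ^ L})"
proof -
  have "(2::nat) ^ (2 ^ L - 1) \<le> 2 ^ (L * card {p::nat. prime p \<and> p \<le> 2 ^ L})"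
    using two_power_le_power_card_primes[of "2 ^ L - 1"] by (simp add: power_mult)
  hence "(2::nat) ^ L - 1 \<le> L * card {p::nat. prime p \<and> p \<le> 2 ^ L}"
    by (rule power_le_imp_le_exp[rotated]) simp
  thus ?thesis by simp
qed

section \<open>The gaps of the semigroup and the size of \<open>G\<close>\<close>

text \<open>Since \<open>x * a + y * (a + 1) = (x + y) * a + y\<close> with
  \<open>y \<le> x + y\<close>, the remainder of \<open>n\<close> can serve as \<open>y\<close> and
  the quotient as \<open>x + y\<close>.\<close>

lemma mem_consecutive_semigroup_iff:
  assumes "a > 0"
  shows "n \<in> consecutive_semigroup a \<longleftrightarrow> n mod a \<le> n div a"
proof
  assume "n \<in> consecutive_semigroup a"
  then obtain x y where "n = x * a + y * (a + 1)" by (auto simp: consecutive_semigroup_def)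
  hence n: "n = y + (x + y) * a" by (simp add: algebra_simps)
  have "n mod a = y mod a" "n div a = x + y + y div a"
    unfolding n using assms by simp_all
  moreover have "y mod a \<le> y" by simp
  ultimately show "n mod a \<le> n div a" by linarith
next
  assume "n mod a \<le> n div a"
  hence "(n div a - n mod a) * a + (n mod a) * (a + 1) = n div a * a + n mod a"
    by (simp add: diff_mult_distrib)
  hence "n = (n div a - n mod a) * a + (n mod a) * (a + 1)" by simp
  thus "n \<in> consecutive_semigroup a" unfolding consecutive_semigroup_def by blast
qed

text \<open>Consecutive intervals of \<open>\<langle>a, a+1\<rangle>\<close> are separated by the gaps \<open>{ja - (a-j), \<dots>, ja - 1}\<close>.
  Here \<open>pG\<close> lies in the gap with \<open>j = a - i\<close>, and the gap with \<open>j = a - p\<close> contains \<open>p\<close>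
  consecutive integers, whence \<open>i \<le> p\<close>.\<close>

lemma G_representation:
  assumes "0 < p" "p < a"
  obtains i s where "i \<le> p" "s \<le> p" "p * G a p + i * a + s = a ^ 2"
proof -
  define U where "U = UNIV - quotient_semigroup (consecutive_semigroup a) p"
  have a: "a > 0" "a \<ge> 2" using assms by auto
  have mem: "n \<in> U \<longleftrightarrow> p * n div a < p * n mod a" for n
    using mem_consecutive_semigroup_iff[OF a(1)]
    by (auto simp: U_def quotient_semigroup_def not_le)
  have fin: "finite U"
    using numerical_semigroup_quotient[OF numerical_semigroup_consecutive[OF a(2)] assms(1)]
    by (simp add: numerical_semigroup_def U_def)
  have ne: "U \<noteq> {}"
    using quotient_consecutive_ne_UNIV[OF assms] by (auto simp: U_def)
  have G: "G a p = Max U" by (simp add: G_def frobenius_number_def U_def)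
  have GU: "G a p \<in> U" unfolding G using fin ne by (rule Max_in)
  \<comment> \<open>This \<open>j\<close> is one less than the index of the gap: it is the quotient
    by \<open>a\<close> of the elements of the gap, whose remainders are the \<open>p\<close>
    numbers from \<open>j + 1\<close> to \<open>a - 1\<close>.\<close>
  define j where "j = a - p - 1"
  have aj: "a = j + p + 1" using assms by (simp add: j_def)
  \<comment> \<open>The last element of the gap. Rounding it down to a multiple of \<open>p\<close>
    moves it by less than \<open>p\<close>, hence stays inside the gap.\<close>
  define t where "t = j * a + (a - 1)"
  have tp: "t mod p < p" using assms by simp
  have pn: "p * (t div p) = (a - 1 - t mod p) + j * a"
  proof -
    have "p * (t div p) = t - t mod p" by (simp add: minus_mod_eq_mult_div)
    thus ?thesis using tp aj by (simp add: t_def)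
  qed
  have lt: "a - 1 - t mod p < a" using a by linarith
  have "p * (t div p) div a = j" "p * (t div p) mod a = a - 1 - t mod p"
    unfolding pn using lt by simp_all
  hence "t div p \<in> U" unfolding mem using tp aj by linarith
  hence "t div p \<le> G a p" unfolding G using fin by simp
  hence low: "(a - 1 - t mod p) + j * a \<le> p * G a p"
    unfolding pn[symmetric] by simp
  define k r where "k = p * G a p div a" and "r = p * G a p mod a"
  have kr: "k < r" "r < a" using GU a unfolding mem k_def r_def by simp_all
  have pG: "p * G a p = k * a + r" by (simp add: k_def r_def)
  have "j \<le> k"
  proof (rule ccontr)
    assume "\<not> j \<le> k"
    hence "Suc k * a \<le> j * a" by (intro mult_right_mono) auto
    thus False using low pG kr by simp
  qed
  \<comment> \<open>Here \<open>j \<le> k\<close> gives \<open>i \<le> p\<close>, and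
    \<open>k < r\<close> gives \<open>s \<le> i\<close>.\<close>
  define i s where "i = a - 1 - k" and "s = a - r"
  have ik: "i + k + 1 = a" and sr: "s + r = a" using kr by (simp_all add: i_def s_def)
  show ?thesis
  proof (rule that)
    show "i \<le> p" using \<open>j \<le> k\<close> ik aj by linarith
    show "s \<le> p" using \<open>j \<le> k\<close> ik sr aj kr by linarith
    have "p * G a p + i * a + s = (i + k) * a + (s + r)" unfolding pG by (simp add: algebra_simps)
    also have "\<dots> = (i + k + 1) * a" unfolding sr by simp
    finally show "p * G a p + i * a + s = a ^ 2" unfolding ik by (simp add: power2_eq_square)
  qed
qed

section \<open>Prime divisors of differences and the larger sieve\<close>

text \<open>Distinct primes are coprime, so their product divides \<open>d\<close>; each factor is
  at least 2.\<close>

lemma card_primes_dvd_le: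
  fixes d :: int
  assumes "d \<noteq> 0" "\<bar>d\<bar> \<le> 2 ^ L" "finite P" "\<And>p. p \<in> P \<Longrightarrow> prime p \<and> int p dvd d"
  shows "card P \<le> L"
proof -
  have dvd: "p dvd nat \<bar>d\<bar>" if "p \<in> P" for p
    using assms(4)[OF that] by (simp add: nat_dvd_iff flip: int_dvd_int_iff)
  have "(2::nat) ^ card P = (\<Prod>p\<in>P. 2)" by simp
  also have "\<dots> \<le> \<Prod>P" by (rule prod_mono) (use assms(4) prime_ge_2_nat in auto)
  also have "\<Prod>P dvd nat \<bar>d\<bar>"
    using assms(3,4) dvd
  proof (induction P rule: finite_induct)
    case (insert q P)
    have "coprime q (\<Prod>P)"
      using insert by (intro prod_coprime_right) (metis insertCI primes_coprime)
    thus ?case using insert.IH insert.prems insert.hyps by (metis divides_mult insertCI prod.insert)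
  qed simp
  hence "\<Prod>P \<le> nat \<bar>d\<bar>" using assms(1) by (intro dvd_imp_le) auto
  also have "\<dots> \<le> 2 ^ L" using assms(2) by (simp add: nat_le_iff)
  finally show ?thesis by simp
qed

text \<open>A weak form of Gallagher's larger sieve: by pigeonhole each prime of \<open>P\<close> divides a
  difference of two of the elements, and no difference has more than \<open>L\<close> prime divisors.\<close>

lemma larger_sieve:
  fixes A P :: "nat set"
  assumes A: "finite A" "card A = Suc K" "\<And>a. a \<in> A \<Longrightarrow> a \<le> 2 ^ L"
    and P: "finite P" "\<And>p. p \<in> P \<Longrightarrow> prime p"
    and classes: "\<And>p. p \<in> P \<Longrightarrow> card ((\<lambda>a. a mod p) ` A) \<le> K"
  shows "card P \<le> (Suc K)\<^sup>2 * L"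
proof -
  define I where "I = {(a, b) \<in> A \<times> A. a \<noteq> b}"
  define D where "D = (\<lambda>(a, b). {p \<in> P. int p dvd int a - int b})"
  have finI: "finite I" using A unfolding I_def by (auto intro: finite_subset[of _ "A \<times> A"])
  have "card I \<le> card (A \<times> A)" by (rule card_mono) (use A in \<open>auto simp: I_def\<close>)
  hence cI: "card I \<le> (Suc K)\<^sup>2" using A by (simp add: card_cartesian_product power2_eq_square)
  have "P \<subseteq> (\<Union>x\<in>I. D x)"
  proof
    fix p assume p: "p \<in> P"
    have "\<not> inj_on (\<lambda>a. a mod p) A"
      using classes[OF p] A card_image by fastforce
    then obtain a b where ab: "a \<in> A" "b \<in> A" "a \<noteq> b" "a mod p = b mod p"
      by (auto simp: inj_on_def)
    hence "int p dvd int a - int b"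
      by (metis mod_eq_dvd_iff of_nat_mod)
    thus "p \<in> (\<Union>x\<in>I. D x)" using ab p by (auto simp: I_def D_def)
  qed
  hence "card P \<le> card (\<Union>x\<in>I. D x)"
    by (rule card_mono[rotated]) (use finI P in \<open>auto simp: D_def\<close>)
  also have "\<dots> \<le> (\<Sum>x\<in>I. card (D x))" using finI by (rule card_UN_le)
  also have "\<dots> \<le> (\<Sum>x\<in>I. L)"
  proof (rule sum_mono)
    fix x assume "x \<in> I"
    then obtain a b where x: "x = (a, b)" "a \<in> A" "b \<in> A" "a \<noteq> b" by (auto simp: I_def)
    have "\<bar>int a - int b\<bar> \<le> int (max a b)" by linarith
    also have "\<dots> \<le> int (2 ^ L)" using A(3) x by (intro of_nat_mono) auto
    finally show "card (D x) \<le> L"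
      using x P by (intro card_primes_dvd_le[of "int a - int b"]) (auto simp: D_def)
  qed
  also have "\<dots> \<le> (Suc K)\<^sup>2 * L" using cI by simp
  finally show ?thesis .
qed

section \<open>Residue classes forced by the values at a fixed \<open>p\<close>\<close>

lemma card_residues_quadratic_le:
  fixes C :: "nat set" and p i s :: nat
  assumes "prime p" "\<And>a. a \<in> C \<Longrightarrow> \<exists>g. p * g + i * a + s = a\<^sup>2"
  shows "card ((\<lambda>a. a mod p) ` C) \<le> 2"
proof (cases "C = {}")
  case False
  then obtain b where b: "b \<in> C" by blast
  \<comment> \<open>The roots of x^2 - i x - s modulo \<open>p\<close> sum to \<open>i\<close>, so
    \<open>i - b\<close> is the root that accompanies \<open>b\<close>.\<close>
  define c where "c = nat ((int i - int b) mod int p)"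
  have "(\<lambda>a. a mod p) ` C \<subseteq> {b mod p, c}"
  proof (intro image_subsetI)
    fix a assume a: "a \<in> C"
    obtain g h where g: "p * g + i * a + s = a\<^sup>2" and h: "p * h + i * b + s = b\<^sup>2"
      using assms(2) a b by blast
    have "int p * int g + int i * int a + int s = (int a)\<^sup>2"
      "int p * int h + int i * int b + int s = (int b)\<^sup>2"
      using g h by (metis of_nat_add of_nat_mult of_nat_power)+
    hence "(int a - int b) * (int a - (int i - int b)) = int p * (int g - int h)"
      by (simp add: algebra_simps power2_eq_square)
    hence "int p dvd (int a - int b) * (int a - (int i - int b))" by simp
    hence "int p dvd int a - int b \<or> int p dvd int a - (int i - int b)"
      using assms(1) by (simp add: prime_dvd_mult_iff)
    thus "a mod p \<in> {b mod p, c}"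
    proof
      assume "int p dvd int a - int b"
      hence "int a mod int p = int b mod int p" by (simp add: mod_eq_dvd_iff)
      thus ?thesis by (simp flip: of_nat_mod)
    next
      assume "int p dvd int a - (int i - int b)"
      hence "int a mod int p = (int i - int b) mod int p" by (simp add: mod_eq_dvd_iff)
      thus ?thesis unfolding c_def by (metis insertI1 insertI2 nat_int of_nat_mod)
    qed
  qed
  hence "card ((\<lambda>a. a mod p) ` C) \<le> card {b mod p, c}" by (rule card_mono[rotated]) simp
  also have "\<dots> \<le> 2" by (simp add: card_insert_if)
  finally show ?thesis .
qed simp

text \<open>Each pair \<open>(A, B)\<close> stands for a rational function of \<open>a\<close>
  alone. The set \<open>X\<close> holds the accidental agreements with a quadratic, namely roots of
  nonzero polynomials; any other agreement is an identity, which determines the quadratic. The 2 in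
  the degree bound is the degree of that quadratic.\<close>

lemma few_residues_of_values:
  fixes V :: "(complex poly \<times> complex poly) set" and H :: "nat set" and p d :: nat
  assumes p: "prime p" and V: "finite V"
    and deg: "\<And>A B. (A, B) \<in> V \<Longrightarrow> B \<noteq> 0 \<and> degree A \<le> d \<and> degree B + 2 \<le> d"
    and H: "\<And>a. a \<in> H \<Longrightarrow> \<exists>(A, B)\<in>V. \<exists>i\<le>p. \<exists>s\<le>p. \<exists>g. p * g + i * a + s = a\<^sup>2 \<and>
      poly A (of_nat a) = of_nat g * poly B (of_nat a)"
  obtains X where "finite X" "card X \<le> card V * (Suc p)\<^sup>2 * d"
    "card ((\<lambda>a. a mod p) ` (H - X)) \<le> 2 * card V"
proof -
  \<comment> \<open>\<open>F (A, B) i s\<close> vanishes at \<open>a\<close> when A/B takes there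
    the value (a^2 - i a - s)/p, and vanishes identically when A/B is that quadratic.\<close>
  define F :: "complex poly \<times> complex poly \<Rightarrow> nat \<Rightarrow> nat \<Rightarrow> complex poly" where
    "F = (\<lambda>(A, B) i s. smult (of_nat p) A - [:- of_nat s, - of_nat i, 1:] * B)"
  define J where "J = {(v, i, s) \<in> V \<times> {..p} \<times> {..p}. F v i s \<noteq> 0}"
  define Y where "Y = (\<lambda>(v, i, s). {a::nat. poly (F v i s) (of_nat a) = 0})"
  define X where "X = (\<Union>x\<in>J. Y x)"
  have finJ: "finite J"
    by (rule finite_subset[of _ "V \<times> {..p} \<times> {..p}"]) (use V in \<open>auto simp: J_def\<close>)
  have "card J \<le> card (V \<times> {..p} \<times> {..p})"
    by (rule card_mono) (use V in \<open>auto simp: J_def\<close>)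
  hence cJ: "card J \<le> card V * (Suc p)\<^sup>2"
    by (simp only: card_cartesian_product card_atMost power2_eq_square)
  have Y: "finite (Y x) \<and> card (Y x) \<le> d" if "x \<in> J" for x
  proof -
    obtain A B i s where x: "x = ((A, B), i, s)" by (metis prod.exhaust)
    have AB: "(A, B) \<in> V" and nz: "F (A, B) i s \<noteq> 0" using that x by (auto simp: J_def)
    let ?R = "{z. poly (F (A, B) i s) z = 0}"
    have Yeq: "of_nat ` Y x \<subseteq> ?R" by (auto simp: Y_def x)
    have fR: "finite ?R" using nz by (rule poly_roots_finite)
    have inj: "inj_on (of_nat :: nat \<Rightarrow> complex) (Y x)" by (auto simp: inj_on_def)
    have "degree ([:- of_nat s, - of_nat i, 1:] * B) \<le> 2 + degree B"
      by (rule order.trans[OF degree_mult_le]) simp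
    hence "degree (F (A, B) i s) \<le> d" unfolding F_def prod.case
      using deg[OF AB] by (intro degree_diff_le) (auto intro: order.trans[OF degree_smult_le])
    hence "card ?R \<le> d" using card_poly_roots_bound[OF nz] by simp
    moreover have "card (Y x) \<le> card ?R"
      using card_mono[OF fR Yeq] card_image[OF inj] by simp
    ultimately show ?thesis using finite_imageD[OF finite_subset[OF Yeq fR] inj] by simp
  qed
  have finX: "finite X" unfolding X_def using finJ Y by blast
  have "card X \<le> (\<Sum>x\<in>J. card (Y x))" unfolding X_def using finJ by (rule card_UN_le)
  also have "\<dots> \<le> (\<Sum>x\<in>J. d)" using Y by (intro sum_mono) blast
  also have "\<dots> \<le> card V * (Suc p)\<^sup>2 * d" using cJ by simp
  finally have cX: "card X \<le> card V * (Suc p)\<^sup>2 * d" .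
  \<comment> \<open>Outside \<open>X\<close>, an element of \<open>H\<close> can only come from a
    pair \<open>(i, s)\<close> for which \<open>F v i s\<close> is the zero polynomial.\<close>
  define C where "C v = {a. \<exists>i s g. F v i s = 0 \<and> p * g + i * a + s = a\<^sup>2}" for v
  have sub: "H - X \<subseteq> (\<Union>v\<in>V. C v)"
  proof
    fix a assume a: "a \<in> H - X"
    then obtain A B i s g where AB: "(A, B) \<in> V" and le: "i \<le> p" "s \<le> p"
      and g: "p * g + i * a + s = a\<^sup>2"
      and val: "poly A (of_nat a) = of_nat g * poly B (of_nat a)"
      using H[of a] by blast
    have "(of_nat p * of_nat g :: complex) = (of_nat a)\<^sup>2 - of_nat i * of_nat a - of_nat s"
      using g[symmetric] by (simp add: eq_diff_eq flip: of_nat_power of_nat_mult of_nat_add)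
    moreover have "poly (F (A, B) i s) (of_nat a) = of_nat p * poly A (of_nat a) -
        ((of_nat a)\<^sup>2 - of_nat i * of_nat a - of_nat s) * poly B (of_nat a)"
      by (simp add: F_def algebra_simps power2_eq_square)
    ultimately have "poly (F (A, B) i s) (of_nat a) = 0"
      using val by (simp flip: mult.assoc)
    moreover have "F (A, B) i s \<noteq> 0 \<Longrightarrow> ((A, B), i, s) \<in> J"
      using AB le by (simp add: J_def)
    ultimately have "F (A, B) i s = 0" using a unfolding X_def Y_def by blast
    thus "a \<in> (\<Union>v\<in>V. C v)" using AB g unfolding C_def by blast
  qed
  have Ccard: "card ((\<lambda>a. a mod p) ` C v) \<le> 2" if v: "v \<in> V" for v
  proof (cases "C v = {}")
    case False
    then obtain i s where F0: "F v i s = 0" unfolding C_def by blast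
    \<comment> \<open>Cancelling \<open>B\<close> leaves an equality of quadratics, so all of
      \<open>C v\<close> shares one pair \<open>(i, s)\<close>.\<close>
    have uniq: "i' = i \<and> s' = s" if "F v i' s' = 0" for i' s'
    proof -
      obtain A B where AB: "v = (A, B)" by (metis prod.exhaust)
      have "B \<noteq> 0" using deg v AB by blast
      moreover have "[:- of_nat s', - of_nat i', 1:] * B = [:- of_nat s, - of_nat i, 1:] * B"
        using that F0 unfolding AB F_def prod.case by (metis eq_iff_diff_eq_0)
      ultimately have "[:- of_nat s', - of_nat i', 1:] = [:- of_nat s, - of_nat i, 1::complex:]"
        by (simp only: mult_cancel_right) simp
      thus ?thesis by simp
    qed
    show ?thesis by (rule card_residues_quadratic_le[OF p, of _ i s]) (use uniq in \<open>auto simp: C_def\<close>)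
  qed simp
  have finmod: "finite ((\<lambda>a. a mod p) ` T)" for T
    by (rule finite_subset[of _ "{..<p}"]) (use prime_gt_0_nat[OF p] in auto)
  have "card ((\<lambda>a. a mod p) ` (H - X)) \<le> card (\<Union>v\<in>V. (\<lambda>a. a mod p) ` C v)"
  proof (rule card_mono)
    show "finite (\<Union>v\<in>V. (\<lambda>a. a mod p) ` C v)" using V finmod by blast
    show "(\<lambda>a. a mod p) ` (H - X) \<subseteq> (\<Union>v\<in>V. (\<lambda>a. a mod p) ` C v)" using sub by blast
  qed
  also have "\<dots> \<le> (\<Sum>v\<in>V. card ((\<lambda>a. a mod p) ` C v))" using V by (rule card_UN_le)
  also have "\<dots> \<le> (\<Sum>v\<in>V. 2)" using Ccard by (intro sum_mono) blast
  also have "\<dots> = 2 * card V" by simp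
  finally show ?thesis by (rule that[OF finX cX])
qed

section \<open>Specialising the second variable\<close>

text \<open>Only finitely many coefficients occur, and the constant \<open>y\<close> does not raise
  their degrees. Uniformity in \<open>y\<close> gives one \<open>d\<close> for all
  \<open>p\<close>.\<close>

lemma degree_poly_const_bounded:
  fixes f :: "'a :: comm_ring_1 poly poly"
  shows "\<exists>d. \<forall>y. degree (poly f [:y:]) \<le> d"
proof (induction f)
  case (pCons q f)
  then obtain d where d: "\<And>y. degree (poly f [:y:]) \<le> d" by blast
  have "degree (poly (pCons q f) [:y:]) \<le> max (degree q) d" for y
    using d[of y] by (auto intro!: degree_add_le order.trans[OF degree_smult_le])
  thus ?case by blast
qed simp

text \<open>Each such \<open>y\<close> gives a root \<open>[:y:]\<close> of \<open>f\<close> in the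
  coefficient ring. Applied to denominators, this leaves out only finitely many
  \<open>p\<close>.\<close>

lemma finite_poly_const_zero:
  fixes f :: "'a :: idom poly poly"
  assumes "f \<noteq> 0"
  shows "finite {y. poly f [:y:] = 0}"
proof -
  have "(\<lambda>y. [:y:]) ` {y. poly f [:y:] = 0} \<subseteq> {z. poly f z = 0}" by auto
  hence "finite ((\<lambda>y. [:y:]) ` {y. poly f [:y:] = 0})"
    using poly_roots_finite[OF assms] finite_subset by blast
  thus ?thesis by (rule finite_imageD) (auto simp: inj_on_def)
qed

text \<open>A fixed representation may have a vanishing denominator where another one does not; the
  multiplied-out form holds for every representation.\<close>

lemma poly_at_rat_at:
  assumes "R = Fract A B" "B \<noteq> 0" "rat_defined_at R x y"
  shows "poly_at A x y = rat_at R x y * poly_at B x y"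
proof -
  obtain A' B' where *: "B' \<noteq> 0" "R = Fract A' B'" "poly_at B' x y \<noteq> 0"
    using assms(3) unfolding rat_defined_at_def by blast
  have "A * B' = A' * B" using * assms by (simp add: eq_fract)
  hence "poly_at A x y * poly_at B' x y = poly_at A' x y * poly_at B x y"
    by (metis poly_at_mult)
  moreover have "rat_at R x y * poly_at B' x y = poly_at A' x y"
    using * rat_at_Fract(2)[OF *(3), of A'] by simp
  ultimately have "poly_at A x y * poly_at B' x y = (rat_at R x y * poly_at B x y) * poly_at B' x y"
    by (simp add: mult.assoc mult.left_commute)
  thus ?thesis using *(3) by simp
qed

section \<open>The sieve against Chebyshev's bound\<close>

lemma not_covered_by_finitely_many_rational_functions:
  fixes Q :: "birat set"
  assumes Q: "finite Q"
    and cover: "\<And>a p. (a, p) \<in> D_pp \<Longrightarrow> \<exists>R\<in>Q. rat_defined_at R (of_nat a) (of_nat p) \<and>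
      of_nat (G a p) = rat_at R (of_nat a) (of_nat p)"
  shows False
proof -
  have "\<exists>A B. R = Fract A B \<and> B \<noteq> 0" for R :: birat by (cases R) auto
  then obtain num den :: "birat \<Rightarrow> bipoly" where rep: "\<And>R. R = Fract (num R) (den R)" "\<And>R. den R \<noteq> 0"
    by metis
  have "\<forall>R. \<exists>d. \<forall>y. degree (poly (num R) [:y:]) \<le> d" "\<forall>R. \<exists>d. \<forall>y. degree (poly (den R) [:y:]) \<le> d"
    by (intro allI degree_poly_const_bounded)+
  then obtain dn dd where dn: "\<And>R y. degree (poly (num R) [:y:]) \<le> dn R"
    and dd: "\<And>R y. degree (poly (den R) [:y:]) \<le> dd R"
    by metis
  define d where "d = (\<Sum>R\<in>Q. dn R + dd R) + 2"
  have le_d: "dn R + dd R + 2 \<le> d" if "R \<in> Q" for R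
    unfolding d_def using member_le_sum[OF that, of "\<lambda>R. dn R + dd R"] Q by simp
  define m where "m = card Q"
  \<comment> \<open>For \<open>p\<close> in \<open>E\<close> some chosen denominator becomes the
    zero polynomial in \<open>a\<close>, and its equation carries no information.\<close>
  define E where "E = {p::nat. \<exists>R\<in>Q. poly (den R) [:of_nat p:] = 0}"
  have "E = (\<Union>R\<in>Q. of_nat -` {y. poly (den R) [:y:] = 0})" by (auto simp: E_def)
  moreover have "finite (of_nat -` {y. poly (den R) [:y:] = 0} :: nat set)" for R
    using finite_poly_const_zero[OF rep(2)] by (rule finite_vimageI) (simp add: inj_def)
  ultimately have finE: "finite E" using Q by simp
  have "\<exists>X. finite X \<and> card X \<le> m * (Suc p)\<^sup>2 * d \<and>
      card ((\<lambda>a. a mod p) ` ({a. prime a \<and> p < a} - X)) \<le> 2 * m"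
    if p: "prime p" "2 < p" "p \<notin> E" for p
  proof -
    define V where "V = (\<lambda>R. (poly (num R) [:of_nat p:], poly (den R) [:of_nat p:])) ` Q"
    have V: "finite V" "card V \<le> m" unfolding V_def m_def using Q by (auto intro: card_image_le)
    obtain X where X: "finite X" "card X \<le> card V * (Suc p)\<^sup>2 * d"
      "card ((\<lambda>a. a mod p) ` ({a. prime a \<and> p < a} - X)) \<le> 2 * card V"
    proof (rule few_residues_of_values[OF p(1) V(1), where d = d and H = "{a. prime a \<and> p < a}"])
      fix A B assume "(A, B) \<in> V"
      then obtain R where R: "R \<in> Q" "A = poly (num R) [:of_nat p:]" "B = poly (den R) [:of_nat p:]"
        by (auto simp: V_def)
      show "B \<noteq> 0 \<and> degree A \<le> d \<and> degree B + 2 \<le> d"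
        using dn[of R "of_nat p"] dd[of R "of_nat p"] le_d[OF R(1)] p(3) R by (auto simp: E_def)
    next
      fix a assume "a \<in> {a. prime a \<and> p < a}"
      hence a: "prime a" "p < a" by auto
      then obtain R where R: "R \<in> Q" "rat_defined_at R (of_nat a) (of_nat p)"
        "of_nat (G a p) = rat_at R (of_nat a) (of_nat p)"
        using cover[of a p] p by (auto simp: D_pp_def)
      have "poly_at (num R) (of_nat a) (of_nat p) = of_nat (G a p) * poly_at (den R) (of_nat a) (of_nat p)"
        unfolding R(3) by (rule poly_at_rat_at[OF rep R(2)])
      moreover obtain i s where "i \<le> p" "s \<le> p" "p * G a p + i * a + s = a\<^sup>2"
        using G_representation[of p a] p a by auto
      ultimately show "\<exists>(A, B)\<in>V. \<exists>i\<le>p. \<exists>s\<le>p. \<exists>g. p * g + i * a + s = a\<^sup>2 \<and>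
          poly A (of_nat a) = of_nat g * poly B (of_nat a)"
        using R(1) unfolding V_def poly_at_def by blast
    qed
    have "card V * (Suc p)\<^sup>2 * d \<le> m * (Suc p)\<^sup>2 * d" using V(2) by simp
    thus ?thesis using X V(2) by (intro exI[of _ X]) linarith
  qed
  then obtain X where X: "\<And>p. prime p \<Longrightarrow> 2 < p \<Longrightarrow> p \<notin> E \<Longrightarrow> finite (X p) \<and>
      card (X p) \<le> m * (Suc p)\<^sup>2 * d \<and> card ((\<lambda>a. a mod p) ` ({a. prime a \<and> p < a} - X p)) \<le> 2 * m"
    by metis
  define K e where "K = 2 * m" and "e = card E"
  \<comment> \<open>By Chebyshev's bound, the first inequality leaves more sieving primes up to 2^l
    than the larger sieve permits; the second leaves more than \<open>K\<close> primes up to 2^(l^2)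
    after all exceptions are removed.\<close>
  have "\<forall>\<^sub>F l in at_top. ((1 + real K)\<^sup>2 * (real l)\<^sup>2 + (real e + 1)) * real l + 1 < 2 ^ l"
    "\<forall>\<^sub>F l in at_top. (real K + 2 ^ l + 2 ^ l * (real m * (1 + 2 ^ l)\<^sup>2 * real d)) * (real l)\<^sup>2 + 1 < 2 ^ (l\<^sup>2)"
    by real_asymp+
  hence "\<forall>\<^sub>F l in at_top.
      ((1 + real K)\<^sup>2 * (real l)\<^sup>2 + (real e + 1)) * real l + 1 < 2 ^ l \<and>
      (real K + 2 ^ l + 2 ^ l * (real m * (1 + 2 ^ l)\<^sup>2 * real d)) * (real l)\<^sup>2 + 1 < 2 ^ (l\<^sup>2)"
    by (rule eventually_conj)
  then obtain l where l:
    "((1 + real K)\<^sup>2 * (real l)\<^sup>2 + (real e + 1)) * real l + 1 < 2 ^ l"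
    "(real K + 2 ^ l + 2 ^ l * (real m * (1 + 2 ^ l)\<^sup>2 * real d)) * (real l)\<^sup>2 + 1 < 2 ^ (l\<^sup>2)"
    using eventually_happens'[OF sequentially_bot] by blast
  define N where "N = (2::nat) ^ l"
  have "real (((Suc K)\<^sup>2 * l\<^sup>2 + (e + 1)) * l + 1) < real N"
    using l(1) by (simp only: N_def of_nat_Suc of_nat_add of_nat_mult of_nat_power of_nat_numeral of_nat_1)
  hence l1: "((Suc K)\<^sup>2 * l\<^sup>2 + (e + 1)) * l + 1 < N" by (simp only: of_nat_less_iff)
  have "real ((K + N + N * (m * (Suc N)\<^sup>2 * d)) * l\<^sup>2 + 1) < real (2 ^ (l\<^sup>2))"
    using l(2) by (simp only: N_def of_nat_Suc of_nat_add of_nat_mult of_nat_power of_nat_numeral of_nat_1)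
  hence l2: "(K + N + N * (m * (Suc N)\<^sup>2 * d)) * l\<^sup>2 + 1 < 2 ^ (l\<^sup>2)" by (simp only: of_nat_less_iff)
  \<comment> \<open>The sieving primes: discarding 2 and \<open>E\<close> costs at most
    \<open>e + 1\<close> primes.\<close>
  define P where "P = {p. prime p \<and> 2 < p \<and> p \<le> N \<and> p \<notin> E}"
  have P: "finite P" "P \<subseteq> {1..N}" by (auto simp: P_def intro: finite_subset[of _ "{..N}"])
  have "{p. prime p \<and> p \<le> N} \<subseteq> P \<union> ({2} \<union> E)"
  proof
    fix p assume "p \<in> {p. prime p \<and> p \<le> N}"
    moreover from this have "p \<ge> 2" by (simp add: prime_ge_2_nat)
    ultimately show "p \<in> P \<union> ({2} \<union> E)" by (auto simp: P_def)
  qed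
  hence "card {p. prime p \<and> p \<le> N} \<le> card (P \<union> ({2} \<union> E))"
    using P finE by (intro card_mono) auto
  also have "\<dots> \<le> card P + card ({2} \<union> E)" by (rule card_Un_le)
  also have "card ({2} \<union> E) \<le> e + 1" using card_Un_le[of "{2}" E] by (simp add: e_def)
  finally have "card {p. prime p \<and> p \<le> N} \<le> card P + (e + 1)" by simp
  hence "l * card {p. prime p \<and> p \<le> N} \<le> l * (card P + (e + 1))" by (rule mult_le_mono2)
  hence "N \<le> 1 + l * (card P + (e + 1))"
    using card_primes_le_two_power[of l, folded N_def] by linarith
  moreover have "l * (card P + (e + 1)) \<le> ((Suc K)\<^sup>2 * l\<^sup>2 + (e + 1)) * l" if "card P \<le> (Suc K)\<^sup>2 * l\<^sup>2"
    using that by (subst mult.commute) (intro mult_le_mono1 add_le_mono1)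
  ultimately have cP: "\<not> card P \<le> (Suc K)\<^sup>2 * l\<^sup>2" using l1 by linarith
  define Y where "Y = (\<Union>p\<in>P. X p)"
  \<comment> \<open>Removing \<open>{1..N}\<close> ensures \<open>a > p\<close> for every
    \<open>p\<close> in \<open>P\<close>; removing \<open>Y\<close> avoids the exceptional sets of
    all these \<open>p\<close> at once.\<close>
  define A0 where "A0 = {a. prime a \<and> a \<le> 2 ^ (l\<^sup>2)} - {1..N} - Y"
  have finX: "finite (X p)" and cX: "card (X p) \<le> m * (Suc N)\<^sup>2 * d" if "p \<in> P" for p
  proof -
    show "finite (X p)" using X[of p] that by (simp add: P_def)
    have "card (X p) \<le> m * (Suc p)\<^sup>2 * d" using X[of p] that by (simp add: P_def)
    also have "\<dots> \<le> m * (Suc N)\<^sup>2 * d"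
      using that by (intro mult_right_mono mult_left_mono power_mono) (auto simp: P_def)
    finally show "card (X p) \<le> m * (Suc N)\<^sup>2 * d" .
  qed
  have finY: "finite Y" unfolding Y_def using P finX by blast
  have "card Y \<le> (\<Sum>p\<in>P. card (X p))" unfolding Y_def using P by (intro card_UN_le)
  also have "\<dots> \<le> (\<Sum>p\<in>P. m * (Suc N)\<^sup>2 * d)" by (intro sum_mono cX)
  also have "\<dots> = card P * (m * (Suc N)\<^sup>2 * d)" by simp
  also have "\<dots> \<le> N * (m * (Suc N)\<^sup>2 * d)"
    using card_mono[OF _ P(2)] by (intro mult_right_mono) auto
  finally have cY: "card Y \<le> N * (m * (Suc N)\<^sup>2 * d)" .
  have finA0: "finite A0" unfolding A0_def by simp
  have "card {a::nat. prime a \<and> a \<le> 2 ^ (l\<^sup>2)} \<le> card (A0 \<union> ({1..N} \<union> Y))"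
    by (rule card_mono) (use finA0 finY in \<open>auto simp: A0_def\<close>)
  also have "\<dots> \<le> card A0 + (card {1..N} + card Y)"
    by (meson add_left_mono card_Un_le le_trans)
  also have "\<dots> \<le> card A0 + N + N * (m * (Suc N)\<^sup>2 * d)" using cY by simp
  finally have "l\<^sup>2 * card {a::nat. prime a \<and> a \<le> 2 ^ (l\<^sup>2)} \<le>
      l\<^sup>2 * (card A0 + N + N * (m * (Suc N)\<^sup>2 * d))" by (rule mult_le_mono2)
  hence "2 ^ (l\<^sup>2) \<le> 1 + l\<^sup>2 * (card A0 + N + N * (m * (Suc N)\<^sup>2 * d))"
    using card_primes_le_two_power[of "l\<^sup>2"] by linarith
  moreover have "l\<^sup>2 * (card A0 + N + N * (m * (Suc N)\<^sup>2 * d)) \<le> (K + N + N * (m * (Suc N)\<^sup>2 * d)) * l\<^sup>2"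
    if "card A0 \<le> K" using that by (subst mult.commute) (intro mult_le_mono1 add_le_mono1)
  ultimately have "Suc K \<le> card A0" using l2 by linarith
  \<comment> \<open>One element more than the \<open>K\<close> residue classes available modulo each
    \<open>p\<close> in \<open>P\<close>.\<close>
  then obtain A where A: "A \<subseteq> A0" "card A = Suc K" "finite A" by (rule obtain_subset_with_card_n)
  have "card P \<le> (Suc K)\<^sup>2 * l\<^sup>2"
  proof (rule larger_sieve[OF A(3,2) _ P(1)])
    fix a assume "a \<in> A"
    thus "a \<le> 2 ^ (l\<^sup>2)" using A by (auto simp: A0_def)
  next
    fix p assume p: "p \<in> P"
    show "prime p" using p by (simp add: P_def)
    have "A \<subseteq> {a. prime a \<and> p < a} - X p"
    proof
      fix a assume "a \<in> A"
      hence "a \<in> A0" using A by blast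
      thus "a \<in> {a. prime a \<and> p < a} - X p"
        using p prime_ge_1_nat[of a] by (auto simp: A0_def Y_def P_def)
    qed
    hence "(\<lambda>a. a mod p) ` A \<subseteq> (\<lambda>a. a mod p) ` ({a. prime a \<and> p < a} - X p)" by blast
    moreover have "finite ((\<lambda>a. a mod p) ` ({a. prime a \<and> p < a} - X p))"
      by (rule finite_subset[of _ "{..<p}"]) (use p in \<open>auto simp: P_def\<close>)
    ultimately have "card ((\<lambda>a. a mod p) ` A) \<le> card ((\<lambda>a. a mod p) ` ({a. prime a \<and> p < a} - X p))"
      by (intro card_mono)
    thus "card ((\<lambda>a. a mod p) ` A) \<le> K" using X[of p] p by (simp add: P_def K_def)
  qed
  thus False using cP by contradiction
qed

section \<open>Polynomials as rational functions, and the three statements\<close>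

lemma rat_at_Fract_one:
  "rat_defined_at (Fract f 1) x y \<and> rat_at (Fract f 1) x y = poly_at f x y"
proof -
  have "poly_at 1 x y = 1" by (simp add: poly_at_def)
  thus ?thesis using rat_at_Fract[of 1 x y f] by simp
qed

theorem corollary1p6:
  shows "(\<nexists>F :: bipoly set. finite F \<and>
            (\<forall>(a, p) \<in> D_pp. \<exists>f\<in>F. of_nat (G a p) = poly_at f (of_nat a) (of_nat p)))
       \<and> (\<nexists>Q :: birat set. finite Q \<and>
            (\<forall>(a, p) \<in> D_pp. \<exists>R\<in>Q. rat_defined_at R (of_nat a) (of_nat p) \<and>
               of_nat (G a p) = rat_at R (of_nat a) (of_nat p)))
       \<and> (\<nexists>(F :: bipoly set) (Q :: birat set). finite F \<and> finite Q \<and>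
            (\<forall>a p. 2 \<le> p \<and> p < a \<longrightarrow>
               (\<exists>f\<in>F. of_nat (G a p) = poly_at f (of_nat a) (of_nat p)) \<or>
               (\<exists>R\<in>Q. rat_defined_at R (of_nat a) (of_nat p) \<and>
                  of_nat (G a p) = rat_at R (of_nat a) (of_nat p))))"
proof -
  \<comment> \<open>A mixed family covering only the prime pairs is already impossible. The three
    claims follow with \<open>Q\<close> empty, with \<open>F\<close> empty, and by restricting to
    prime pairs.\<close>
  have key: False if fin: "finite F" "finite Q"
    and cover: "\<And>a p. (a, p) \<in> D_pp \<Longrightarrow>
      (\<exists>f\<in>F. of_nat (G a p) = poly_at f (of_nat a) (of_nat p)) \<or>
      (\<exists>R\<in>Q. rat_defined_at R (of_nat a) (of_nat p) \<and>
         of_nat (G a p) = rat_at R (of_nat a) (of_nat p))"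
    for F :: "bipoly set" and Q :: "birat set"
  proof (rule not_covered_by_finitely_many_rational_functions[of "(\<lambda>f. Fract f 1) ` F \<union> Q"])
    show "finite ((\<lambda>f. Fract f 1) ` F \<union> Q)" using fin by simp
    fix a p assume "(a, p) \<in> D_pp"
    from cover[OF this]
    show "\<exists>R\<in>(\<lambda>f. Fract f 1) ` F \<union> Q. rat_defined_at R (of_nat a) (of_nat p) \<and>
        of_nat (G a p) = rat_at R (of_nat a) (of_nat p)"
      unfolding bex_Un by (auto simp: rat_at_Fract_one)
  qed
  show ?thesis
  proof (intro conjI notI; elim exE conjE)
    fix F :: "bipoly set"
    assume "finite F" "\<forall>(a, p)\<in>D_pp. \<exists>f\<in>F. of_nat (G a p) = poly_at f (of_nat a) (of_nat p)"
    thus False by (intro key[of F "{}"]) auto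
  next
    fix Q :: "birat set"
    assume "finite Q" "\<forall>(a, p)\<in>D_pp. \<exists>R\<in>Q. rat_defined_at R (of_nat a) (of_nat p) \<and>
      of_nat (G a p) = rat_at R (of_nat a) (of_nat p)"
    thus False by (intro key[of "{}" Q]) auto
  next
    fix F :: "bipoly set" and Q :: "birat set"
    assume fin: "finite F" "finite Q"
      and cover: "\<forall>a p. 2 \<le> p \<and> p < a \<longrightarrow>
        (\<exists>f\<in>F. of_nat (G a p) = poly_at f (of_nat a) (of_nat p)) \<or>
        (\<exists>R\<in>Q. rat_defined_at R (of_nat a) (of_nat p) \<and>
           of_nat (G a p) = rat_at R (of_nat a) (of_nat p))"
    show False
    proof (rule key[OF fin])
      fix a p assume "(a, p) \<in> D_pp"
      hence "2 \<le> p \<and> p < a" by (auto simp: D_pp_def)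
      thus "(\<exists>f\<in>F. of_nat (G a p) = poly_at f (of_nat a) (of_nat p)) \<or>
          (\<exists>R\<in>Q. rat_defined_at R (of_nat a) (of_nat p) \<and>
             of_nat (G a p) = rat_at R (of_nat a) (of_nat p))"
        using cover by (elim allE[of _ a] allE[of _ p]) (rule mp)
    qed
  qed
qed

end
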